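(* Let $f$ be a generator on $\mathbb{D}$ with $f(0)=0$ and $q=f'(0)$, $\operatorname{Re} q>0$, and let $G_r=(\mathrm{Id}+rf)^{-1}$ be its nonlinear resolvent, where $r\ge\frac{6}{\operatorname{Re} q}$. Then the semigroup generated by $G_r$ admits analytic extension with respect to the semigroup parameter to a sector of opening $\pi\,\dfrac{r\operatorname{Re} q-6}{r\operatorname{Re} q+6}$.
   Context: $\mathbb{D}=\{z\in\mathbb{C}:|z|<1\}$. A holomorphic function $g:\mathbb{D}\to\mathbb{C}$ is called a generator if for every $z\in\mathbb{D}$ the Cauchy problem $\frac{\partial u(t,z)}{\partial t}+g(u(t,z))=0$, $u(0,z)=z$, has a unique solution $u(t,z)\in\mathbb{D}$ defined for all $t\ge 0$; the family $\{u(t,\cdot)\}_{t\ge0}$ is then called the semigroup generated by $g$, and $t$ is the semigroup parameter. For a generator $f$ and $r>0$, it is known that $(\mathrm{Id}+rf)(\mathbb{D})\supset\mathbb{D}$ and that $G_r:=(\mathrm{Id}+rf)^{-1}$ is a well-defined holomorphic (univalent) self-mapping of $\mathbb{D}$, called the nonlinear resolvent of $f$. When $f(0)=0$, it is known that $G_r$ is itself a generator. A sector of opening $\omega$ is a set of the form $\{t\in\mathbb{C}\setminus\{0\}: |\arg t-\varphi|<\omega/2\}$ for some $\varphi\in\mathbb{R}$ (empty if $\omega=0$). Analytic extension of the semigroup to a sector means that for every $z\in\mathbb{D}$ the function $t\mapsto u(t,z)$ can be analytically extended to that sector. *)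

theory Defs
  imports "HOL-Complex_Analysis.Complex_Analysis"
begin

abbreviation unit_disc :: "complex set" where
  "unit_disc \<equiv> ball 0 1"

definition cauchy_solution ::
    "(complex \<Rightarrow> complex) \<Rightarrow> complex \<Rightarrow> (real \<Rightarrow> complex) \<Rightarrow> bool" where
  "cauchy_solution g z u \<longleftrightarrow>
     u 0 = z \<and>
     (\<forall>t\<ge>0. u t \<in> unit_disc \<and> (u has_vector_derivative - g (u t)) (at t within {0..}))"

(* Solutions are total functions on the reals, so uniqueness is agreement on [0, \<infinity>). *)
definition generator :: "(complex \<Rightarrow> complex) \<Rightarrow> bool" where
  "generator g \<longleftrightarrow>
     g holomorphic_on unit_disc \<and>
     (\<forall>z\<in>unit_disc. \<exists>u. cauchy_solution g z u \<and>
        (\<forall>v. cauchy_solution g z v \<longrightarrow> (\<forall>t\<ge>0. v t = u t)))"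

(* Meaningful for a generator g, z in the disc and t \<ge> 0. *)
definition generated_semigroup ::
    "(complex \<Rightarrow> complex) \<Rightarrow> real \<Rightarrow> complex \<Rightarrow> complex" where
  "generated_semigroup g t z = (THE w. \<exists>u. cauchy_solution g z u \<and> u t = w)"

(* Only the values on the disc matter: for a generator f and r > 0, every point of the
   disc has exactly one preimage in the disc under Id + r f. *)
definition nonlinear_resolvent ::
    "real \<Rightarrow> (complex \<Rightarrow> complex) \<Rightarrow> complex \<Rightarrow> complex" where
  "nonlinear_resolvent r f = inv_into unit_disc (\<lambda>z. z + of_real r * f z)"

(* All values of the argument are admitted, so a sector may cross the negative real axis. *)
definition sector :: "real \<Rightarrow> real \<Rightarrow> complex set" where
  "sector \<phi> \<omega> = {t. t \<noteq> 0 \<and> (\<exists>\<theta>. is_Arg t \<theta> \<and> \<bar>\<theta> - \<phi>\<bar> < \<omega> / 2)}"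

(* A nonempty sector has to contain the open positive half-line, where the semigroup is
   given; otherwise "extension" would be void. The direction \<phi> does not depend on z. *)
definition semigroup_extends_to_sector_of_opening ::
    "(complex \<Rightarrow> complex) \<Rightarrow> real \<Rightarrow> bool" where
  "semigroup_extends_to_sector_of_opening g \<omega> \<longleftrightarrow>
     (\<exists>\<phi>. (sector \<phi> \<omega> \<noteq> {} \<longrightarrow> of_real ` {0<..} \<subseteq> sector \<phi> \<omega>) \<and>
        (\<forall>z\<in>unit_disc. \<exists>F. F holomorphic_on sector \<phi> \<omega> \<and>
           (\<forall>t>0. of_real t \<in> sector \<phi> \<omega> \<longrightarrow> F (of_real t) = generated_semigroup g t z)))"

end

theory Submission
  imports Defs
begin

text \<open>
  By the Schwarz lemma the semigroup of \<open>f\<close> does not increase moduli, so \<open>f z = z * p z\<close>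
  with \<open>Re p \<ge> 0\<close> and \<open>p 0 = q\<close> (\<open>generator_inward\<close>). This needs the flow to be holomorphic
  in the initial value, which follows from the uniform convergence of Euler polygons
  (\<open>flow_holomorphic\<close>). The resolvent satisfies \<open>G w * (1 + r p (G w)) = w\<close>, so
  \<open>G w = w * h w\<close> with \<open>1 / h = 1 + r p \<circ> G\<close>.

  Put \<open>s = r Re q \<ge> 6\<close>. By Harnack's inequality the image of \<open>G\<close> lies in the disc of radius
  \<open>1 / (s - 1)\<close>, and there \<open>p\<close> is close to \<open>q\<close>: the values of \<open>1 / h\<close> lie in the disc
  with centre \<open>c = 1 + r q\<close> and radius \<open>\<rho> = 2 s / (s - 2) \<le> 3\<close>. Hence they lie in a sector
  around the direction of \<open>c\<close> with half-angle \<open>arcsin (\<rho> / norm c)\<close>, which is at most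
  \<open>arcsin (3 / (s + 1))\<close>. The direction of \<open>c\<close> itself may be nearly imaginary, so the
  sector of times found in the end need not be symmetric about the real axis.

  It remains to solve \<open>u' = - u h(u)\<close> in complex time (\<open>complex_time_flow\<close>). In the logarithmic
  coordinate \<open>v\<close> on the left half-plane the equation is \<open>P(v)' = - 1\<close>, where
  \<open>P' (v) = 1 / h (exp v)\<close>. As \<open>P'\<close> has its values in a disc that does not contain the origin,
  \<open>P\<close> is injective with Lipschitz inverse, and the solution \<open>exp (P\<^sup>-\<^sup>1 (P(v(0)) - \<tau>))\<close> exists
  for every complex time \<open>\<tau>\<close> for which the motion never goes to the right, that is for
  \<open>Re (\<tau> * cnj \<kappa>) \<ge> 0\<close> on the disc of possible difference quotients \<open>\<kappa>\<close> of \<open>P\<close>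
  (\<open>cone_in_image\<close>). The disc lies in the right half-plane, so this includes the real times
  \<open>\<tau> \<ge> 0\<close> and shows that \<open>G\<close> is a generator. The cone of all such \<open>\<tau>\<close> has half-angle
  \<open>pi/2 - arcsin (\<rho> / norm c)\<close>. By Jordan's inequality for the sine this is at least half the
  required opening, and a sector of that opening around the positive half-line fits into the cone
  (\<open>sector_in_time_cone\<close>).
\<close>

section \<open>Solutions and the semigroup law\<close>

lemma cauchy_solution_in_disc:
  assumes "cauchy_solution g z u" "t \<ge> 0"
  shows "norm (u t) < 1"
  using assms by (simp add: cauchy_solution_def)

lemma cauchy_solution_derivative:
  assumes "cauchy_solution g z u" "t \<ge> 0"
  shows "(u has_vector_derivative - g (u t)) (at t within {0..})"
  using assms by (simp add: cauchy_solution_def)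

lemma continuous_on_cauchy_solution:
  assumes "cauchy_solution g z u"
  shows "continuous_on {0..} u"
  using cauchy_solution_derivative[OF assms]
  by (auto simp: continuous_on_eq_continuous_within intro: has_vector_derivative_continuous)

lemma generated_semigroup_eq:
  assumes "generator g" "cauchy_solution g z u" "t \<ge> 0"
  shows "generated_semigroup g t z = u t"
proof -
  have "z \<in> unit_disc"
    using assms(2) by (auto simp: cauchy_solution_def)
  then obtain w where w: "\<And>v. cauchy_solution g z v \<Longrightarrow> v t = w"
    using assms unfolding generator_def by metis
  then show ?thesis
    unfolding generated_semigroup_def using assms(2) by (intro the_equality) auto
qed

lemma cauchy_solution_generated_semigroup:
  assumes "generator g" "norm z < 1"
  shows "cauchy_solution g z (\<lambda>t. generated_semigroup g t z)"
proof -
  obtain u where u: "cauchy_solution g z u"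
    using assms unfolding generator_def by fastforce
  have eq: "generated_semigroup g t z = u t" if "t \<ge> 0" for t
    using generated_semigroup_eq[OF assms(1) u that] .
  show ?thesis
    unfolding cauchy_solution_def
  proof (intro conjI allI impI)
    show "generated_semigroup g 0 z = z"
      using u by (simp add: eq cauchy_solution_def)
  next
    fix t :: real assume t: "0 \<le> t"
    show "generated_semigroup g t z \<in> unit_disc"
      using u t by (simp add: eq cauchy_solution_def)
    have "((\<lambda>t. generated_semigroup g t z) has_vector_derivative - g (u t)) (at t within {0..})"
      using cauchy_solution_derivative[OF u t]
      by (rule has_vector_derivative_transform[rotated 2]) (use t eq in auto)
    then show "((\<lambda>t. generated_semigroup g t z) has_vector_derivative
                  - g (generated_semigroup g t z)) (at t within {0..})"
      by (simp add: eq t)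
  qed
qed

lemma cauchy_solution_shift:
  assumes u: "cauchy_solution g z u" and s: "s \<ge> 0"
  shows "cauchy_solution g (u s) (\<lambda>t. u (s + t))"
  unfolding cauchy_solution_def
proof (intro conjI allI impI)
  show "u (s + 0) = u s" by simp
next
  fix t :: real assume t: "0 \<le> t"
  show "u (s + t) \<in> unit_disc"
    using cauchy_solution_in_disc[OF u, of "s + t"] s t by simp
  have "((\<lambda>t. s + t) has_vector_derivative 1) (at t within {0..})"
    by (auto intro!: derivative_eq_intros)
  moreover have "(u has_vector_derivative - g (u (s + t))) (at (s + t) within (\<lambda>t. s + t) ` {0..})"
    by (rule has_vector_derivative_within_subset[OF cauchy_solution_derivative[OF u]])
       (use s t in auto)
  ultimately show "((\<lambda>t. u (s + t)) has_vector_derivative - g (u (s + t))) (at t within {0..})"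
    using vector_diff_chain_within[of "\<lambda>t. s + t" 1 t "{0..}" u] by (simp add: o_def)
qed

lemma generated_semigroup_add:
  assumes "generator g" "norm z < 1" "s \<ge> 0" "t \<ge> 0"
  shows "generated_semigroup g (s + t) z = generated_semigroup g t (generated_semigroup g s z)"
  using generated_semigroup_eq[OF assms(1)
      cauchy_solution_shift[OF cauchy_solution_generated_semigroup[OF assms(1,2)] assms(3)] assms(4)]
  by simp

text \<open>
  Before the first time at which a trajectory reaches the larger circle its speed is at most
  \<open>M\<close>, so it needs time at least \<open>(R' - R) / M\<close> to get there.
\<close>

lemma trajectory_confined:
  assumes u: "cauchy_solution f z u"
    and M: "\<And>x. norm x \<le> R' \<Longrightarrow> norm (f x) \<le> M"
    and z: "norm z \<le> R" and small: "M * \<eta> < R' - R" and R': "R < R'"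
    and t: "0 \<le> t" "t \<le> \<eta>"
  shows "norm (u t) \<le> R'"
proof (rule ccontr)
  assume neg: "\<not> norm (u t) \<le> R'"
  have cont: "continuous_on {0..t} u"
    using continuous_on_cauchy_solution[OF u] by (rule continuous_on_subset) auto
  define S where "S = {0..t} \<inter> (\<lambda>x. norm (u x)) -` {R'..}"
  have "closed S"
    unfolding S_def using cont
    by (intro continuous_closed_preimage continuous_on_norm) auto
  have S: "S \<noteq> {}" "bdd_below S" using t neg by (auto simp: S_def)
  define s where "s = Inf S"
  have sS: "s \<in> S"
    unfolding s_def using S \<open>closed S\<close> by (intro closed_contains_Inf)
  have before: "norm (u x) < R'" if "0 \<le> x" "x < s" for x
  proof (rule ccontr)
    assume "\<not> norm (u x) < R'"
    then have "x \<in> S" using that sS by (auto simp: S_def)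
    then show False using cInf_lower[OF _ S(2)] that s_def by fastforce
  qed
  have u0: "u 0 = z" using u by (simp add: cauchy_solution_def)
  have "s > 0"
    using sS u0 z R' by (cases "s = 0") (auto simp: S_def)
  have "norm (u s - u 0) \<le> M * s - M * 0"
  proof (rule differentiable_bound_general[OF \<open>s > 0\<close>])
    show "continuous_on {0..s} u"
      using cont by (rule continuous_on_subset) (use sS in \<open>auto simp: S_def\<close>)
    show "(u has_vector_derivative - f (u x)) (at x)" if "0 < x" "x < s" for x
      using cauchy_solution_derivative[OF u, of x] that at_within_interior[of x "{0..}"]
      by simp
    show "((\<lambda>t. M * t) has_vector_derivative M) (at x)" for x
      by (auto intro!: derivative_eq_intros simp: has_real_derivative_iff_has_vector_derivative[symmetric])
    show "norm (- f (u x)) \<le> M" if "0 < x" "x < s" for x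
      using M[of "u x"] before[of x] that by simp
  qed (auto intro!: continuous_intros)
  moreover have "M * s \<le> M * \<eta>"
  proof (rule mult_left_mono)
    show "s \<le> \<eta>" using sS t by (auto simp: S_def)
    have "norm z \<le> R'" using z R' by simp
    then show "0 \<le> M" using M[of z] norm_ge_zero[of "f z"] by linarith
  qed
  ultimately have "norm (u s) < R'"
    using z small u0 norm_triangle_ineq2[of "u s" z] by simp
  then show False using sS by (auto simp: S_def)
qed

section \<open>Holomorphic dependence on the initial value\<close>

text \<open>
  The Euler polygons \<open>(id - (t/n) f)\<^sup>n\<close> are holomorphic in the initial value because they
  are compositions of holomorphic maps, and on a smaller disc they converge uniformly to the flow
  as long as neither they nor the trajectories can leave a slightly larger disc. The time for
  which this works depends on the two radii.
\<close>

lemma flow_holomorphic_short_time: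
  assumes f: "generator f" and R: "R < R'" "R' < 1"
  shows "\<exists>\<eta>>0. \<forall>t. 0 \<le> t \<and> t \<le> \<eta> \<longrightarrow> generated_semigroup f t holomorphic_on ball 0 R"
proof -
  have holf: "f holomorphic_on ball 0 1"
    using f by (simp add: generator_def)
  have sub: "cball 0 R' \<subseteq> (ball 0 1 :: complex set)" using R by auto
  have "compact (f ` cball 0 R')"
    by (intro compact_continuous_image holomorphic_on_imp_continuous_on
        holomorphic_on_subset[OF holf sub]) auto
  then obtain M where M: "M > 0" "\<And>x. norm x \<le> R' \<Longrightarrow> norm (f x) \<le> M"
    using compact_imp_bounded bounded_pos[of "f ` cball 0 R'"] by auto
  have "compact (deriv f ` cball 0 R')"
    by (intro compact_continuous_image holomorphic_on_imp_continuous_on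
        holomorphic_on_subset[OF holomorphic_deriv[OF holf] sub]) auto
  then obtain L where L: "L > 0" "\<And>x. norm x \<le> R' \<Longrightarrow> norm (deriv f x) \<le> L"
    using compact_imp_bounded bounded_pos[of "deriv f ` cball 0 R'"] by auto
  have lip: "norm (f x - f y) \<le> L * norm (x - y)" if "norm x \<le> R'" "norm y \<le> R'" for x y
  proof (rule field_differentiable_bound[of "cball 0 R'"])
    show "(f has_field_derivative deriv f z) (at z within cball 0 R')" if "z \<in> cball 0 R'" for z
      using holomorphic_derivI[OF holf, of z] that sub by (auto intro: has_field_derivative_at_within)
  qed (use that L in auto)
  define \<eta> where "\<eta> = (R' - R) / (2 * M)"
  have \<eta>: "\<eta> > 0" "M * \<eta> < R' - R" using R M(1) by (auto simp: \<eta>_def)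
  have "generated_semigroup f t holomorphic_on ball 0 R" if t: "0 \<le> t" "t \<le> \<eta>" for t
  proof -
    define h where "h n = t / real (Suc n)" for n
    define E where "E n x = x - of_real (h n) * f x" for n x
    have h0: "h n \<ge> 0" for n using t by (simp add: h_def)
    have kh: "real k * h n \<le> t" if "k \<le> Suc n" for k n
    proof -
      have "real k * t \<le> real (Suc n) * t" using that t by (intro mult_right_mono) auto
      then show ?thesis by (simp add: h_def field_simps)
    qed
    have dist_E: "norm ((E n ^^ k) z - z) \<le> real k * h n * M \<and> norm ((E n ^^ k) z) \<le> R'"
      if "norm z < R" "k \<le> Suc n" for z k n
      using that(2)
    proof (induction k)
      case 0
      then show ?case using that R by simp
    next
      case (Suc k)
      then have IH: "norm ((E n ^^ k) z - z) \<le> real k * h n * M" "norm ((E n ^^ k) z) \<le> R'"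
        by auto
      have "norm (of_real (h n) * f ((E n ^^ k) z)) \<le> h n * M"
        using M(2)[OF IH(2)] h0[of n] by (simp add: norm_mult mult_left_mono)
      moreover have "(E n ^^ Suc k) z - z = ((E n ^^ k) z - z) - of_real (h n) * f ((E n ^^ k) z)"
        by (simp add: E_def)
      ultimately have 1: "norm ((E n ^^ Suc k) z - z) \<le> real (Suc k) * h n * M"
        using IH(1) norm_triangle_ineq4[of "(E n ^^ k) z - z" "of_real (h n) * f ((E n ^^ k) z)"]
        unfolding of_nat_Suc distrib_right by (simp only:)
      \<comment> \<open>The choice of \<open>\<eta>\<close> keeps the polygon, like the trajectory, inside the larger disc.\<close>
      have "real (Suc k) * h n * M \<le> \<eta> * M"
        using kh[OF Suc.prems] t M(1) by (intro mult_right_mono) auto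
      then have "norm ((E n ^^ Suc k) z) \<le> R'"
        using 1 \<eta>(2) that(1) norm_triangle_ineq2[of "(E n ^^ Suc k) z" z]
        by (simp add: mult.commute)
      with 1 show ?case by simp
    qed
    have hol: "(E n ^^ k) holomorphic_on ball 0 R" if "k \<le> Suc n" for k n
      using that
    proof (induction k)
      case 0
      then show ?case by (simp add: id_def)
    next
      case (Suc k)
      have "norm ((E n ^^ k) x) < 1" if "norm x < R" for x
        using dist_E[OF that, of k n] Suc.prems R(2) by simp
      then have "f \<circ> (E n ^^ k) holomorphic_on ball 0 R"
        using Suc holf by (intro holomorphic_on_compose_gen[of _ _ _ "ball 0 1"]) auto
      then have "(\<lambda>z. (E n ^^ k) z - of_real (h n) * f ((E n ^^ k) z)) holomorphic_on ball 0 R"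
        using Suc by (intro holomorphic_intros) (auto simp: o_def)
      then show ?case unfolding funpow.simps o_def by (subst E_def)
    qed
    \<comment> \<open>Each step commits a local error of at most \<open>L M h\<^sup>2\<close>, and each later step multiplies an
      error that is already there by at most \<open>1 + h L\<close>.\<close>
    have err: "norm ((E n ^^ k) z - generated_semigroup f (real k * h n) z)
                 \<le> real k * (L * M * (h n)\<^sup>2) * (1 + h n * L) ^ k"
      if z: "norm z < R" and "k \<le> Suc n" for z k n
      using that(2)
    proof (induction k)
      case 0
      have "norm z < 1" using z R by simp
      then have "generated_semigroup f 0 z = z"
        using cauchy_solution_generated_semigroup[OF f] by (simp add: cauchy_solution_def)
      then show ?case by simp
    next
      case (Suc k)
      have z1: "norm z < 1" using z R by simp
      define u where "u t = generated_semigroup f t z" for t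
      have u: "cauchy_solution f z u"
        using cauchy_solution_generated_semigroup[OF f z1] by (simp add: u_def[abs_def])
      define s where "s = real k * h n"
      have s: "0 \<le> s" "s + h n \<le> t"
        using kh[OF Suc.prems] h0[of n] by (auto simp: s_def algebra_simps)
      define x where "x = (E n ^^ k) z"
      have xR: "norm x \<le> R'" using dist_E[OF z, of k n] Suc.prems by (simp add: x_def)
      have uR: "norm (u a) \<le> R'" if "0 \<le> a" "a \<le> t" for a
        using trajectory_confined[OF u M(2) less_imp_le[OF z] \<eta>(2) R(1), of a] that t by simp
      have deriv_u: "(u has_vector_derivative - f (u a)) (at a within {s..s + h n})"
        if "a \<in> {s..s + h n}" for a
        using cauchy_solution_derivative[OF u, of a] that s
        by (auto intro: has_vector_derivative_within_subset)
      have move: "norm (u a - u s) \<le> M * h n" if a: "a \<in> {s..s + h n}" for a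
      proof -
        have "norm (u a - u s) \<le> M * norm (a - s)"
        proof (rule differentiable_bound[of "{s..s + h n}" u "\<lambda>b y. y *\<^sub>R - f (u b)"])
          show "(u has_derivative (\<lambda>y. y *\<^sub>R - f (u b))) (at b within {s..s + h n})"
            if "b \<in> {s..s + h n}" for b
            using deriv_u[OF that] by (simp add: has_vector_derivative_def)
          show "onorm (\<lambda>y. y *\<^sub>R - f (u b)) \<le> M" if "b \<in> {s..s + h n}" for b
          proof (rule onorm_le)
            have "norm (f (u b)) \<le> M" using M(2)[OF uR, of b] that s by simp
            from mult_left_mono[OF this abs_ge_zero]
            show "norm (y *\<^sub>R - f (u b)) \<le> M * norm y" for y by (simp add: mult.commute)
          qed
        qed (use a in auto)
        also have "\<dots> \<le> M * h n" using a M(1) by (intro mult_left_mono) auto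
        finally show ?thesis .
      qed
      have local: "norm (u (s + h n) - (u s - of_real (h n) * f (u s))) \<le> L * M * (h n)\<^sup>2"
      proof -
        have "norm (u (s + h n) - u s - (s + h n - s) *\<^sub>R (- f (u s)))
                \<le> norm (s + h n - s) * (L * (M * h n))"
        proof (rule vector_differentiable_bound_linearization[of "{s..s + h n}"])
          show "norm (- f (u a) - - f (u s)) \<le> L * (M * h n)" if "a \<in> {s..s + h n}" for a
          proof -
            have "norm (- f (u a) - - f (u s)) = norm (f (u a) - f (u s))"
              by (simp add: norm_minus_commute)
            also have "\<dots> \<le> L * norm (u a - u s)"
              using that s h0[of n] by (intro lip uR) auto
            also have "\<dots> \<le> L * (M * h n)"
              using move[OF that] L(1) by (intro mult_left_mono) auto
            finally show ?thesis .
          qed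
        qed (use deriv_u h0[of n] in \<open>auto simp: closed_segment_eq_real_ivl\<close>)
        then show ?thesis using h0[of n]
          by (simp add: scaleR_conv_of_real power2_eq_square algebra_simps)
      qed
      have "norm (x - of_real (h n) * f x - (u s - of_real (h n) * f (u s)))
              \<le> norm (x - u s) + norm (of_real (h n) * (f x - f (u s)))"
        using norm_triangle_ineq4[of "x - u s" "of_real (h n) * (f x - f (u s))"]
        by (simp add: algebra_simps)
      also have "\<dots> \<le> norm (x - u s) + h n * (L * norm (x - u s))"
        using lip[OF xR uR[of s]] s h0[of n] by (auto simp: norm_mult intro!: mult_left_mono)
      also have "\<dots> = (1 + h n * L) * norm (x - u s)"
        by (simp add: algebra_simps)
      also have "\<dots> \<le> (1 + h n * L) * (real k * (L * M * (h n)\<^sup>2) * (1 + h n * L) ^ k)"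
        using Suc h0[of n] L(1) by (intro mult_left_mono) (auto simp: x_def u_def s_def)
      finally have "norm (x - of_real (h n) * f x - u (s + h n))
          \<le> real k * (L * M * (h n)\<^sup>2) * (1 + h n * L) ^ Suc k + L * M * (h n)\<^sup>2"
        using local norm_triangle_ineq4[of "x - of_real (h n) * f x - (u s - of_real (h n) * f (u s))"
            "u (s + h n) - (u s - of_real (h n) * f (u s))"]
        by (simp add: algebra_simps)
      also have "\<dots> \<le> real k * (L * M * (h n)\<^sup>2) * (1 + h n * L) ^ Suc k
                       + L * M * (h n)\<^sup>2 * (1 + h n * L) ^ Suc k"
      proof -
        have "1 \<le> (1 + h n * L) ^ Suc k" using h0[of n] L(1) by (intro one_le_power) auto
        then show ?thesis
          using mult_left_mono[of 1 "(1 + h n * L) ^ Suc k" "L * M * (h n)\<^sup>2"] L M by simp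
      qed
      finally have bound: "norm (x - of_real (h n) * f x - u (s + h n))
          \<le> real (Suc k) * (L * M * (h n)\<^sup>2) * (1 + h n * L) ^ Suc k"
        by (simp add: algebra_simps)
      have "(E n ^^ Suc k) z = x - of_real (h n) * f x"
        unfolding funpow.simps o_def x_def by (subst E_def) (rule refl)
      moreover have "s + h n = real (Suc k) * h n" by (simp add: s_def algebra_simps)
      ultimately show ?case using bound by (simp only: u_def)
    qed
    define C where "C = L * M * t\<^sup>2 * exp (t * L)"
    have unif: "norm ((E n ^^ Suc n) z - generated_semigroup f t z) \<le> C / real (Suc n)"
      if "norm z < R" for z n
    proof -
      have eq: "real (Suc n) * h n = t" by (simp add: h_def)
      have "(1 + h n * L) ^ Suc n \<le> exp (t * L)"
        using exp_ge_one_plus_x_over_n_power_n[of "Suc n" "t * L"] t L(1)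
          order_trans[of "- real (Suc n)" 0 "t * L"] by (simp add: h_def)
      then have "real (Suc n) * (L * M * (h n)\<^sup>2) * (1 + h n * L) ^ Suc n
                   \<le> real (Suc n) * (L * M * (h n)\<^sup>2) * exp (t * L)"
        using L M by (intro mult_left_mono) auto
      also have "\<dots> = C / real (Suc n)"
        by (simp add: C_def h_def power2_eq_square divide_simps)
      finally show ?thesis
        using err[OF that, of "Suc n" n] unfolding eq by simp
    qed
    show ?thesis
    proof (rule holomorphic_uniform_sequence[of "ball 0 R" "\<lambda>n. E n ^^ Suc n"])
      fix z :: complex assume "z \<in> ball 0 R"
      then obtain d where d: "d > 0" "cball z d \<subseteq> ball 0 R"
        using open_contains_cball[of "ball 0 R"] open_ball by blast
      have "uniform_limit (cball z d) (\<lambda>n. E n ^^ Suc n) (generated_semigroup f t) sequentially"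
      proof (rule uniform_limitI)
        fix e :: real assume "e > 0"
        have "(\<lambda>n. C / real (Suc n)) \<longlonglongrightarrow> 0"
          by (rule LIMSEQ_Suc[OF lim_const_over_n])
        then have "\<forall>\<^sub>F n in sequentially. C / real (Suc n) < e"
          using \<open>e > 0\<close> by (rule order_tendstoD)
        then show "\<forall>\<^sub>F n in sequentially. \<forall>x\<in>cball z d.
                     dist ((E n ^^ Suc n) x) (generated_semigroup f t x) < e"
        proof eventually_elim
          case (elim n)
          show ?case
          proof
            fix x assume "x \<in> cball z d"
            then have "norm x < R" using d(2) by auto
            from le_less_trans[OF unif[OF this] elim]
            show "dist ((E n ^^ Suc n) x) (generated_semigroup f t x) < e"
              by (simp only: dist_norm)
          qed
        qed
      qed
      with d show "\<exists>d>0. cball z d \<subseteq> ball 0 R \<and>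
          uniform_limit (cball z d) (\<lambda>n. E n ^^ Suc n) (generated_semigroup f t) sequentially"
        by blast
    qed (simp_all add: hol del: funpow.simps)
  qed
  with \<eta>(1) show ?thesis by blast
qed

text \<open>
  A single trajectory on \<open>[0, T]\<close> is compact, so it lies in some disc \<open>ball 0 R\<close> with
  \<open>R < 1\<close>. The time \<open>T\<close> is then cut into equal steps that are short enough for that
  disc, and near the given initial value the time \<open>T\<close> map is the composition of the
  corresponding short time maps.
\<close>

lemma flow_holomorphic:
  assumes f: "generator f" and T: "0 \<le> T"
  shows "generated_semigroup f T holomorphic_on ball 0 1"
proof -
  have "\<exists>d>0. generated_semigroup f T holomorphic_on ball z d" if z: "norm z < 1" for z
  proof -
    define u where "u t = generated_semigroup f t z" for t
    have u: "cauchy_solution f z u"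
      using cauchy_solution_generated_semigroup[OF f z] by (simp add: u_def[abs_def])
    have "continuous_on {0..T} u"
      by (rule continuous_on_subset[OF continuous_on_cauchy_solution[OF u]]) auto
    then have "compact ((\<lambda>t. norm (u t)) ` {0..T})"
      by (intro compact_continuous_image continuous_intros) auto
    then obtain m where m: "m \<in> {0..T}" "\<And>t. t \<in> {0..T} \<Longrightarrow> norm (u t) \<le> norm (u m)"
      using compact_attains_sup[of "(\<lambda>t. norm (u t)) ` {0..T}"] T by auto
    have "norm (u m) < 1" using cauchy_solution_in_disc[OF u, of m] m by simp
    then obtain R where "norm (u m) < R" "R < 1" using dense by blast
    then have R: "R < 1" "\<And>t. 0 \<le> t \<Longrightarrow> t \<le> T \<Longrightarrow> norm (u t) < R"
      using m(2) by (auto intro: le_less_trans)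
    obtain R' where R': "R < R'" "R' < 1" using dense R by blast
    obtain \<eta> where \<eta>: "\<eta> > 0"
      "\<And>t. 0 \<le> t \<Longrightarrow> t \<le> \<eta> \<Longrightarrow> generated_semigroup f t holomorphic_on ball 0 R"
      using flow_holomorphic_short_time[OF f R'] by blast
    obtain n :: nat where n: "T / \<eta> < real n" using reals_Archimedean2 by blast
    then have npos: "n > 0" using T \<eta>(1) by (cases n) (auto simp: field_simps)
    define h where "h = T / real n"
    have h: "0 \<le> h" "h \<le> \<eta>" "real n * h = T"
      using T n npos \<eta>(1) by (auto simp: h_def field_simps)
    have "\<exists>d>0. ball z d \<subseteq> ball 0 1 \<and> generated_semigroup f (real k * h) holomorphic_on ball z d"
      if "k \<le> n" for k
      using that
    proof (induction k)
      case 0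
      have "generated_semigroup f 0 holomorphic_on ball 0 1"
      proof (rule holomorphic_transform[OF holomorphic_on_id])
        show "id x = generated_semigroup f 0 x" if "x \<in> ball 0 1" for x
          using cauchy_solution_generated_semigroup[OF f, of x] that
          by (simp add: cauchy_solution_def)
      qed
      moreover obtain d where "d > 0" "ball z d \<subseteq> ball 0 1"
        using z openE[of "ball 0 1 :: complex set" z] by auto
      ultimately show ?case by (auto intro: holomorphic_on_subset)
    next
      case (Suc k)
      then obtain d where d: "d > 0" "ball z d \<subseteq> ball 0 1"
        "generated_semigroup f (real k * h) holomorphic_on ball z d" by auto
      have kT: "0 \<le> real k * h" "real k * h \<le> T"
        using Suc.prems h mult_right_mono[of "real k" "real n" h] by auto
      have "open (ball z d \<inter> generated_semigroup f (real k * h) -` ball 0 R)"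
        by (rule continuous_open_preimage[OF holomorphic_on_imp_continuous_on[OF d(3)]]) auto
      moreover have "z \<in> ball z d \<inter> generated_semigroup f (real k * h) -` ball 0 R"
        using R(2)[OF kT] d(1) by (simp add: u_def)
      ultimately obtain d' where d': "d' > 0"
        "ball z d' \<subseteq> ball z d \<inter> generated_semigroup f (real k * h) -` ball 0 R"
        using open_contains_ball by meson
      have "generated_semigroup f h \<circ> generated_semigroup f (real k * h) holomorphic_on ball z d'"
        using d' \<eta>(2)[OF h(1,2)]
        by (intro holomorphic_on_compose_gen[of _ _ _ "ball 0 R"] holomorphic_on_subset[OF d(3)]) auto
      then have "generated_semigroup f (real (Suc k) * h) holomorphic_on ball z d'"
      proof (rule holomorphic_transform)
        fix x assume "x \<in> ball z d'"
        then have "x \<in> ball 0 1" using d' d(2) by blast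
        then have "norm x < 1" by simp
        then show "(generated_semigroup f h \<circ> generated_semigroup f (real k * h)) x =
                   generated_semigroup f (real (Suc k) * h) x"
          using generated_semigroup_add[OF f, of x "real k * h" h] kT(1) h(1)
          by (simp add: algebra_simps)
      qed
      with d' d(2) show ?case by blast
    qed
    from this[of n] show ?thesis using h(3) by auto
  qed
  then have "generated_semigroup f T field_differentiable at z" if "norm z < 1" for z
    using holomorphic_on_imp_differentiable_at[of "generated_semigroup f T"] that by force
  then show ?thesis
    by (auto simp: holomorphic_on_def intro: field_differentiable_at_within)
qed

section \<open>Generators that vanish at the origin\<close>

text \<open>
  By the Schwarz lemma a holomorphic flow that fixes the origin does not increase the modulus.
  Hence the derivative of the squared modulus along a trajectory, which is
  \<open>- 2 Re (cnj z * f z)\<close> at the initial time, is not positive.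
\<close>

lemma generator_inward:
  assumes f: "generator f" and f0: "f 0 = 0" and z: "norm z < 1"
  shows "0 \<le> Re (cnj z * f z)"
proof -
  define u where "u t = generated_semigroup f t z" for t
  have u: "cauchy_solution f z u"
    using cauchy_solution_generated_semigroup[OF f z] by (simp add: u_def[abs_def])
  have zero: "cauchy_solution f 0 (\<lambda>t. 0)"
    by (simp add: cauchy_solution_def f0)
  have le: "norm (u t) \<le> norm z" if t: "t \<ge> 0" for t
    unfolding u_def
  proof (rule Schwarz_Lemma(1)[OF flow_holomorphic[OF f t] _ _ z])
    show "generated_semigroup f t 0 = 0" using generated_semigroup_eq[OF f zero t] .
    show "norm (generated_semigroup f t x) < 1" if "norm x < 1" for x
      using cauchy_solution_in_disc[OF cauchy_solution_generated_semigroup[OF f that] t] .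
  qed
  have u0: "u 0 = z" using u by (simp add: cauchy_solution_def)
  have du: "(u has_vector_derivative - f z) (at 0 within {0..})"
    using cauchy_solution_derivative[OF u, of 0] u0 by simp
  have "((\<lambda>t. u t \<bullet> u t) has_vector_derivative (z \<bullet> - f z + - f z \<bullet> z)) (at 0 within {0..})"
    using bounded_bilinear.has_vector_derivative[OF bounded_bilinear_inner du du] u0 by simp
  then have "((\<lambda>t. (u t \<bullet> u t - z \<bullet> z) / t) \<longlongrightarrow> - 2 * Re (cnj z * f z)) (at 0 within {0..})"
    using u0 by (simp add: has_real_derivative_iff_has_vector_derivative[symmetric]
        has_field_derivative_iff inner_complex_def algebra_simps)
  moreover have "\<forall>\<^sub>F t in at 0 within {0..}. (u t \<bullet> u t - z \<bullet> z) / t \<le> 0"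
  proof (rule eventually_mono[OF eventually_at_filter[THEN iffD2, OF always_eventually]])
    show "\<forall>t. t \<noteq> 0 \<longrightarrow> t \<in> {0..} \<longrightarrow> t > (0::real)" by auto
    show "(u t \<bullet> u t - z \<bullet> z) / t \<le> 0" if "t > 0" for t
      using le[of t] that power_mono[of "norm (u t)" "norm z" 2]
      by (auto simp: power2_norm_eq_inner[symmetric] divide_le_0_iff)
  qed
  moreover have "at 0 within {0..} \<noteq> (bot :: real filter)"
    by (simp add: at_within_Ici_at_right)
  ultimately have "- 2 * Re (cnj z * f z) \<le> 0"
    by (intro tendsto_upperbound)
  then show ?thesis by simp
qed

section \<open>Holomorphic functions with nonnegative real part\<close>

text \<open>
  The version of the Schwarz lemma for maps into the closed disc, by applying the usual one to
  \<open>e * \<phi>\<close> for \<open>e < 1\<close>.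
\<close>

lemma schwarz_closed:
  assumes "\<phi> holomorphic_on ball 0 1" "\<phi> 0 = 0"
    and le: "\<And>z. norm z < 1 \<Longrightarrow> norm (\<phi> z) \<le> 1" and z: "norm z < 1"
  shows "norm (\<phi> z) \<le> norm z"
proof -
  have scaled: "e * norm (\<phi> z) \<le> norm z" if e: "0 < e" "e < 1" for e
  proof -
    have "norm ((\<lambda>x. of_real e * \<phi> x) z) \<le> norm z"
    proof (rule Schwarz_Lemma(1)[OF _ _ _ z])
      show "(\<lambda>x. of_real e * \<phi> x) holomorphic_on ball 0 1"
        by (intro holomorphic_intros assms)
      show "norm (of_real e * \<phi> x) < 1" if "norm x < 1" for x
      proof -
        have "norm (of_real e * \<phi> x) = e * norm (\<phi> x)" using e by (simp add: norm_mult)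
        also have "\<dots> \<le> e * 1" using e by (intro mult_left_mono le that) auto
        finally show ?thesis using e by simp
      qed
    qed (use assms in auto)
    then show ?thesis using e by (simp add: norm_mult)
  qed
  show ?thesis
  proof (rule field_le_mult_one_interval)
    show "x * norm (\<phi> z) \<le> norm z" if "0 < x" "x < 1" for x
      using scaled[OF that] .
  qed
qed

text \<open>
  The Cayley transform \<open>(p - p 0) / (p + cnj (p 0))\<close> maps the half-plane to the disc and
  vanishes at the origin, so its modulus at \<open>z\<close> is at most that of \<open>z\<close>. Solving for
  \<open>p z\<close> gives both estimates.
\<close>

lemma harnack:
  assumes p: "p holomorphic_on ball 0 1" and re: "\<And>z. norm z < 1 \<Longrightarrow> 0 \<le> Re (p z)"
    and q: "0 < Re (p 0)" and z: "norm z < 1"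
  shows norm_diff_le_of_Re_nonneg: "norm (p z - p 0) \<le> 2 * Re (p 0) * norm z / (1 - norm z)"
    and Re_ge_of_Re_nonneg: "Re (p 0) * (1 - norm z) / (1 + norm z) \<le> Re (p z)"
proof -
  define q where "q = p 0"
  have rq: "Re q > 0" using q by (simp add: q_def)
  define \<phi> where "\<phi> x = (p x - q) / (p x + cnj q)" for x
  have den: "p x + cnj q \<noteq> 0" if "norm x < 1" for x
  proof -
    have "Re (p x + cnj q) > 0" using re[OF that] rq by simp
    then show ?thesis by (metis less_irrefl zero_complex.sel(1))
  qed
  have \<phi>: "norm (\<phi> z) \<le> norm z"
  proof (rule schwarz_closed[OF _ _ _ z])
    show "\<phi> holomorphic_on ball 0 1"
      unfolding \<phi>_def using den by (intro holomorphic_intros p) auto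
    show "\<phi> 0 = 0" by (simp add: \<phi>_def q_def)
    show "norm (\<phi> x) \<le> 1" if x: "norm x < 1" for x
    proof -
      have "(norm (p x - q))\<^sup>2 \<le> (norm (p x + cnj q))\<^sup>2"
        using mult_nonneg_nonneg[OF re[OF x] less_imp_le[OF rq]]
        unfolding cmod_power2 by (simp add: power2_eq_square algebra_simps)
      then have "norm (p x - q) \<le> norm (p x + cnj q)" by (rule power2_le_imp_le) simp
      then show ?thesis using den[OF x] by (simp add: \<phi>_def norm_divide)
    qed
  qed
  then have \<phi>1: "norm (\<phi> z) < 1" using z by simp
  then have ne: "1 - \<phi> z \<noteq> 0" by auto
  have "\<phi> z * (p z + cnj q) = p z - q" using den[OF z] by (simp add: \<phi>_def)
  then have sol: "p z * (1 - \<phi> z) = q + cnj q * \<phi> z"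
    by (simp add: algebra_simps)
  have qq: "q + cnj q = of_real (2 * Re q)" by (simp add: complex_add_cnj)
  have "(p z - q) * (1 - \<phi> z) = (q + cnj q) * \<phi> z"
    using sol by (simp add: algebra_simps)
  then have "p z - q = of_real (2 * Re q) * \<phi> z / (1 - \<phi> z)"
    using ne unfolding qq by (simp add: field_simps)
  then have "norm (p z - q) = 2 * Re q * norm (\<phi> z) / norm (1 - \<phi> z)"
    using rq by (simp add: norm_mult norm_divide)
  also have "\<dots> \<le> 2 * Re q * norm z / (1 - norm z)"
    using rq \<phi> z norm_triangle_ineq2[of 1 "\<phi> z"] by (intro frac_le mult_left_mono) auto
  finally show "norm (p z - p 0) \<le> 2 * Re (p 0) * norm z / (1 - norm z)"
    by (simp add: q_def)
  have "(p z + cnj q) * (1 - \<phi> z) = q + cnj q"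
    using sol by (simp add: algebra_simps)
  then have "p z = (2 * Re q) *\<^sub>R (1 / (1 - \<phi> z)) - cnj q"
    using ne unfolding qq scaleR_conv_of_real by (simp add: field_simps)
  then have "Re (p z) = Re ((2 * Re q) *\<^sub>R (1 / (1 - \<phi> z)) - cnj q)" by simp
  then have Rep: "Re (p z) = 2 * Re q * Re (1 / (1 - \<phi> z)) - Re q"
    unfolding minus_complex.sel scaleR_complex.sel by simp
  have "1 / (1 + norm z) \<le> Re (1 / (1 - \<phi> z))"
  proof -
    have "1 / (1 + norm z) \<le> 1 / (1 + norm (\<phi> z))" using \<phi> by (intro frac_le) (auto intro: add_pos_nonneg)
    also have "\<dots> \<le> Re (1 / (1 - \<phi> z))"
    proof -
      let ?w = "\<phi> z"
      have n: "(norm (1 - ?w))\<^sup>2 > 0" using ne by simp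
      have "(norm (1 - ?w))\<^sup>2 \<le> (1 - Re ?w) * (1 + norm ?w)"
      proof -
        have "(norm (1 - ?w))\<^sup>2 = 1 - 2 * Re ?w + (norm ?w)\<^sup>2"
          unfolding cmod_power2 by (simp add: power2_eq_square algebra_simps)
        also have "\<dots> \<le> (1 - Re ?w) * (1 + norm ?w)"
        proof -
          have "0 \<le> (norm ?w + Re ?w) * (1 - norm ?w)"
            using \<phi>1 abs_Re_le_cmod[of ?w] by (intro mult_nonneg_nonneg) auto
          then show ?thesis by (simp add: algebra_simps power2_eq_square)
        qed
        finally show ?thesis .
      qed
      then have "1 / (1 + norm ?w) \<le> (1 - Re ?w) / (norm (1 - ?w))\<^sup>2"
        using n by (simp add: divide_simps add_pos_nonneg mult.commute)
      also have "\<dots> = Re (1 / (1 - ?w))"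
        by (simp add: Re_divide cmod_power2)
      finally show ?thesis .
    qed
    finally show ?thesis .
  qed
  then have "2 * Re q * (1 / (1 + norm z)) - Re q \<le> Re (p z)"
    unfolding Rep using rq by (intro diff_right_mono mult_left_mono) auto
  moreover have "2 * Re q * (1 / (1 + norm z)) - Re q = Re q * (1 - norm z) / (1 + norm z)"
    using add_pos_nonneg[OF zero_less_one norm_ge_zero[of z]] by (simp add: field_simps)
  ultimately show "Re (p 0) * (1 - norm z) / (1 + norm z) \<le> Re (p z)"
    by (simp add: q_def)
qed

section \<open>The nonlinear resolvent\<close>

text \<open>
  Brouwer's theorem gives a fixed point \<open>a\<close>. If there were a second one, then conjugating by
  the disc automorphism that moves \<open>a\<close> to the origin would give a self-map of the disc with
  equality in the Schwarz lemma, hence a rotation, which fixes a point other than the origin and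
  so is the identity; but the identity does not map the disc into a smaller one.
\<close>

lemma unique_fixed_point_of_shrinking_map:
  assumes hol: "\<Psi> holomorphic_on ball 0 1"
    and shrink: "\<And>z. norm z < 1 \<Longrightarrow> norm (\<Psi> z) \<le> s" and s: "s < 1"
  shows "\<exists>!z. norm z < 1 \<and> \<Psi> z = z"
proof -
  have s0: "s \<ge> 0" using order_trans[OF norm_ge_zero shrink[of 0]] by simp
  obtain a where "a \<in> cball 0 s" "\<Psi> a = a"
  proof (rule brouwer[of "cball 0 s" \<Psi>])
    show "continuous_on (cball 0 s) \<Psi>"
      by (rule continuous_on_subset[OF holomorphic_on_imp_continuous_on[OF hol]]) (use s in auto)
  qed (use s0 s shrink in auto)
  then have a: "norm a < 1" "\<Psi> a = a" using s by auto
  have "b = a" if b: "norm b < 1" "\<Psi> b = b" for b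
  proof (rule ccontr)
    assume ne: "b \<noteq> a"
    let ?m = "Moebius_function 0 a" and ?m' = "Moebius_function 0 (-a)"
    have a': "norm (- a) < 1" using a by simp
    have m'm: "?m' (?m z) = z" "?m (?m' z) = z" if "norm z < 1" for z
      using Moebius_function_compose[of "-a" a z] Moebius_function_compose[of a "-a" z] a that by auto
    define \<xi> where "\<xi> = ?m b"
    have \<xi>: "norm \<xi> < 1" "\<xi> \<noteq> 0"
      using Moebius_function_norm_lt_1[OF a(1) b(1)] m'm(1)[OF b(1)] ne
      by (auto simp: \<xi>_def Moebius_function_of_zero)
    define \<Phi> where "\<Phi> = ?m \<circ> (\<Psi> \<circ> ?m')"
    have in1: "norm (\<Psi> z) < 1" if "norm z < 1" for z using shrink[OF that] s by simp
    have "\<Phi> holomorphic_on ball 0 1"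
      unfolding \<Phi>_def
      using Moebius_function_holomorphic[OF a(1)] Moebius_function_holomorphic[OF a'] hol
        Moebius_function_norm_lt_1[OF a'] in1
      by (intro holomorphic_on_compose_gen[of _ _ _ "ball 0 1"]) auto
    moreover have "\<Phi> 0 = 0"
      using a(2) by (simp add: \<Phi>_def Moebius_function_def)
    moreover have "norm (\<Phi> z) < 1" if "norm z < 1" for z
      using Moebius_function_norm_lt_1 a(1) a' in1 that by (simp add: \<Phi>_def)
    moreover have fix\<xi>: "\<Phi> \<xi> = \<xi>"
      using m'm(1)[OF b(1)] b(2) by (simp add: \<Phi>_def \<xi>_def)
    ultimately obtain \<alpha> where \<alpha>: "\<And>z. norm z < 1 \<Longrightarrow> \<Phi> z = \<alpha> * z"
      using Schwarz_Lemma(3)[of \<Phi> \<xi>] \<xi> by metis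
    have "\<alpha> = 1" using \<alpha>[OF \<xi>(1)] fix\<xi> \<xi>(2) by simp
    have id: "\<Psi> z = z" if z: "norm z < 1" for z
    proof -
      have "norm (?m z) < 1" using Moebius_function_norm_lt_1[OF a(1) z] .
      from \<alpha>[OF this] have "?m (\<Psi> z) = ?m z"
        using \<open>\<alpha> = 1\<close> m'm(1)[OF z] by (simp add: \<Phi>_def)
      then show ?thesis using m'm(1)[OF z] m'm(1)[OF in1[OF z]] by metis
    qed
    obtain x where x: "s < x" "x < 1" using dense s by blast
    then have "norm (of_real x :: complex) < 1" using s0 by simp
    from shrink[OF this] id[OF this] show False using x s0 by simp
  qed
  with a show ?thesis by blast
qed

text \<open>
  The equation \<open>z + r f z = w\<close> says that \<open>z\<close> is a fixed point of
  \<open>\<lambda>z. w / (1 + r p z)\<close>, and this map sends the disc into \<open>cball 0 (norm w)\<close> because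
  the denominator has real part at least \<open>1\<close>. So \<open>Id + r f\<close> takes each value in the
  disc exactly once, and its inverse is holomorphic.
\<close>

lemma resolvent_of_generator:
  assumes p: "p holomorphic_on ball 0 1" and fp: "\<And>z. norm z < 1 \<Longrightarrow> f z = z * p z"
    and re: "\<And>z. norm z < 1 \<Longrightarrow> 0 \<le> Re (p z)" and r: "r > 0"
  defines "G \<equiv> nonlinear_resolvent r f"
  shows nonlinear_resolvent_holomorphic: "G holomorphic_on ball 0 1"
    and nonlinear_resolvent_in_disc: "norm w < 1 \<Longrightarrow> norm (G w) < 1"
    and nonlinear_resolvent_eq: "norm w < 1 \<Longrightarrow> G w * (1 + of_real r * p (G w)) = w"
proof -
  define F where "F z = z + of_real r * f z" for z
  have Re1: "Re (1 + of_real r * p z) \<ge> 1" if "norm z < 1" for z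
    using re[OF that] r by simp
  have norm1: "norm (1 + of_real r * p z) \<ge> 1" if "norm z < 1" for z
    using Re1[OF that] complex_Re_le_cmod[of "1 + of_real r * p z"] by linarith
  then have ne: "1 + of_real r * p z \<noteq> 0" if "norm z < 1" for z
    using that by fastforce
  have F: "F z = z * (1 + of_real r * p z)" if "norm z < 1" for z
    using fp[OF that] by (simp add: F_def algebra_simps)
  have unique: "\<exists>!z. norm z < 1 \<and> F z = w" if w: "norm w < 1" for w
  proof -
    have "\<exists>!z. norm z < 1 \<and> w / (1 + of_real r * p z) = z"
    proof (rule unique_fixed_point_of_shrinking_map[OF _ _ w])
      show "(\<lambda>z. w / (1 + of_real r * p z)) holomorphic_on ball 0 1"
        using ne by (intro holomorphic_intros p) auto
      show "norm (w / (1 + of_real r * p z)) \<le> norm w" if "norm z < 1" for z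
        using norm1[OF that] mult_left_mono[OF norm1[OF that], of "norm w"]
        by (simp add: norm_divide divide_le_eq)
    qed
    moreover have "w / (1 + of_real r * p z) = z \<longleftrightarrow> F z = w" if "norm z < 1" for z
      using ne[OF that] F[OF that] by (auto simp: divide_eq_eq)
    ultimately show ?thesis by metis
  qed
  have G: "norm (G w) < 1 \<and> F (G w) = w" if w: "norm w < 1" for w
  proof -
    obtain z where "norm z < 1" "F z = w" using unique[OF w] by blast
    then have "w \<in> F ` ball 0 1" by (intro image_eqI[of _ _ z]) auto
    moreover have "G w = inv_into (ball 0 1) F w"
      unfolding G_def nonlinear_resolvent_def F_def[abs_def] ..
    ultimately show ?thesis
      using inv_into_into[of w F "ball 0 1"] f_inv_into_f[of w F "ball 0 1"] by simp
  qed
  show "norm (G w) < 1" if "norm w < 1" for w using G[OF that] by simp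
  show "G w * (1 + of_real r * p (G w)) = w" if "norm w < 1" for w
    using G[OF that] F by metis
  have holF: "F holomorphic_on ball 0 1"
    by (rule holomorphic_transform[of "\<lambda>z. z * (1 + of_real r * p z)"])
       (use F p in \<open>auto intro!: holomorphic_intros\<close>)
  define S where "S = ball 0 1 \<inter> F -` ball 0 1"
  have "open S"
    unfolding S_def by (intro continuous_open_preimage holomorphic_on_imp_continuous_on holF) auto
  moreover have "F holomorphic_on S" by (rule holomorphic_on_subset[OF holF]) (auto simp: S_def)
  moreover have "inj_on F S"
  proof (rule inj_onI)
    fix x y assume xy: "x \<in> S" "y \<in> S" "F x = F y"
    then have "norm (F y) < 1" "norm x < 1" "norm y < 1" by (auto simp: S_def)
    then show "x = y" using unique[of "F y"] xy(3) by blast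
  qed
  ultimately obtain g where g: "g holomorphic_on F ` S" "\<And>z. z \<in> S \<Longrightarrow> g (F z) = z"
    using holomorphic_has_inverse by blast
  have GS: "G w \<in> S \<and> F (G w) = w" if "norm w < 1" for w
    using G[OF that] that by (simp add: S_def)
  have "ball 0 1 \<subseteq> F ` S"
  proof
    fix w :: complex assume "w \<in> ball 0 1"
    then show "w \<in> F ` S" using GS[of w] by (auto intro: image_eqI[of _ _ "G w"])
  qed
  then have "g holomorphic_on ball 0 1" using g(1) holomorphic_on_subset by blast
  then show "G holomorphic_on ball 0 1"
  proof (rule holomorphic_transform)
    show "g w = G w" if "w \<in> ball 0 1" for w
      using GS[of w] g(2)[of "G w"] that by simp
  qed
qed

section \<open>Flows in complex time\<close>

text \<open>
  For \<open>\<rho> \<ge> 0\<close> these are the \<open>\<tau>\<close> with \<open>Re (\<tau> * cnj \<kappa>) \<ge> 0\<close> for all \<open>\<kappa>\<close> in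
  \<open>cball c \<rho>\<close>, since the minimum of that real part over the disc is
  \<open>Re (\<tau> * cnj c) - \<rho> * norm \<tau>\<close>. If \<open>\<rho> < norm c\<close>, this is the closed cone around
  the direction of \<open>c\<close> with half-angle \<open>arccos (\<rho> / norm c)\<close>.
\<close>

definition time_cone :: "complex \<Rightarrow> real \<Rightarrow> complex set" where
  "time_cone c \<rho> = {\<tau>. \<rho> * norm \<tau> \<le> Re (\<tau> * cnj c)}"

lemma convex_time_cone:
  assumes "\<rho> \<ge> 0"
  shows "convex (time_cone c \<rho>)"
proof (rule convexI)
  fix x y :: complex and u v :: real
  assume xy: "x \<in> time_cone c \<rho>" "y \<in> time_cone c \<rho>" and uv: "0 \<le> u" "0 \<le> v"
  have "\<rho> * norm (u *\<^sub>R x + v *\<^sub>R y) \<le> \<rho> * (u * norm x + v * norm y)"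
    using norm_triangle_ineq[of "u *\<^sub>R x" "v *\<^sub>R y"] uv assms by (intro mult_left_mono) auto
  also have "\<dots> = u * (\<rho> * norm x) + v * (\<rho> * norm y)" by (simp add: algebra_simps)
  also have "\<dots> \<le> u * Re (x * cnj c) + v * Re (y * cnj c)"
    using xy uv by (intro add_mono mult_left_mono) (auto simp: time_cone_def)
  also have "\<dots> = Re ((u *\<^sub>R x + v *\<^sub>R y) * cnj c)" by (simp add: algebra_simps)
  finally show "u *\<^sub>R x + v *\<^sub>R y \<in> time_cone c \<rho>" by (simp add: time_cone_def)
qed

lemma of_real_in_time_cone:
  assumes "\<rho> \<le> Re c" "t \<ge> 0"
  shows "of_real t \<in> time_cone c \<rho>"
  using assms mult_right_mono[of \<rho> "Re c" t] by (simp add: time_cone_def mult.commute)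

text \<open>
  In the coordinate \<open>v = Ln u\<close> the equation \<open>u' = - u h(u)\<close> becomes
  \<open>k(v) v' = - 1\<close> with \<open>k(v) = 1 / h(exp v)\<close> on the left half-plane. If \<open>P\<close> is a
  primitive of \<open>k\<close>, this reads \<open>P(v(t)) = P(v(0)) - t\<close>. The locale collects what makes this
  formula meaningful for complex \<open>t\<close>: difference quotients of \<open>P\<close> stay in the disc
  \<open>cball c \<rho>\<close>, which does not contain the origin.
\<close>

locale nearly_linear_on_half_plane =
  fixes P k :: "complex \<Rightarrow> complex" and c :: complex and \<rho> :: real
  assumes deriv_P: "Re v < 0 \<Longrightarrow> (P has_field_derivative k v) (at v)"
    and k_near: "Re v < 0 \<Longrightarrow> norm (k v - c) \<le> \<rho>"
    and \<rho>: "\<rho> < norm c"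
begin

lemma \<rho>_nonneg: "\<rho> \<ge> 0"
  using order_trans[OF norm_ge_zero k_near[of "-1"]] by simp

lemma increment_near:
  assumes "Re a < 0" "Re b < 0"
  shows "norm (P b - P a - c * (b - a)) \<le> \<rho> * norm (b - a)"
proof -
  have "norm ((P b - c * b) - (P a - c * a)) \<le> \<rho> * norm (b - a)"
  proof (rule field_differentiable_bound[of "{v. Re v < 0}"])
    show "((\<lambda>v. P v - c * v) has_field_derivative k v - c) (at v within {v. Re v < 0})"
      if "v \<in> {v. Re v < 0}" for v
      using that
      by (auto intro!: derivative_eq_intros has_field_derivative_at_within[OF deriv_P])
  qed (use assms k_near convex_halfspace_Re_lt in auto)
  then show ?thesis by (simp add: algebra_simps)
qed

lemma expanding:
  assumes "Re a < 0" "Re b < 0"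
  shows "(norm c - \<rho>) * norm (b - a) \<le> norm (P b - P a)"
proof -
  have "norm c * norm (b - a) - norm (P b - P a) \<le> norm (P b - P a - c * (b - a))"
    using norm_triangle_ineq2[of "c * (b - a)" "P b - P a"]
    by (simp add: norm_mult norm_minus_commute)
  then show ?thesis using increment_near[OF assms] by (simp add: left_diff_distrib)
qed

lemma inj_P: "inj_on P {v. Re v < 0}"
proof (rule inj_onI)
  fix a b assume "a \<in> {v. Re v < 0}" "b \<in> {v. Re v < 0}" "P a = P b"
  then have "(norm c - \<rho>) * norm (b - a) \<le> 0" using expanding[of a b] by simp
  then show "a = b" using \<rho> by (simp add: mult_le_0_iff)
qed

lemma holomorphic_P: "P holomorphic_on {v. Re v < 0}"
  using deriv_P holomorphic_on_open[OF open_halfspace_Re_lt] by blast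

lemma open_image: "open (P ` {v. Re v < 0})"
  using open_mapping_thm3[OF holomorphic_P open_halfspace_Re_lt inj_P] .

text \<open>
  The difference quotient \<open>\<kappa>\<close> of \<open>P\<close> between \<open>a\<close> and \<open>b\<close> lies in \<open>cball c \<rho>\<close>
  and \<open>b - a = - \<tau> / \<kappa>\<close>, so that \<open>Re (b - a)\<close> has the sign of
  \<open>- Re (\<tau> * cnj \<kappa>)\<close>.
\<close>

lemma cone_step_moves_left:
  assumes a: "Re a < 0" and b: "Re b < 0" and \<tau>: "\<tau> \<in> time_cone c \<rho>" and eq: "P b = P a - \<tau>"
  shows "Re b \<le> Re a"
proof (cases "b = a")
  case False
  define \<kappa> where "\<kappa> = (P b - P a) / (b - a)"
  have \<tau>\<kappa>: "\<tau> = - (\<kappa> * (b - a))" using False eq by (simp add: \<kappa>_def)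
  have "(\<kappa> - c) * (b - a) = P b - P a - c * (b - a)"
    using False unfolding left_diff_distrib by (simp add: \<kappa>_def)
  then have "norm ((\<kappa> - c) * (b - a)) \<le> \<rho> * norm (b - a)"
    using increment_near[OF a b] by simp
  then have near: "norm (\<kappa> - c) \<le> \<rho>" using False by (simp add: norm_mult)
  have "norm (\<tau> * cnj (\<kappa> - c)) \<le> \<rho> * norm \<tau>"
    using mult_left_mono[OF near norm_ge_zero[of \<tau>]]
    by (simp add: norm_mult mult.commute del: complex_cnj_diff)
  then have "Re (\<tau> * cnj (\<kappa> - c)) \<ge> - (\<rho> * norm \<tau>)"
    using abs_Re_le_cmod[of "\<tau> * cnj (\<kappa> - c)"] by linarith
  then have "Re (\<tau> * cnj \<kappa>) \<ge> 0"
    using \<tau> by (simp add: time_cone_def algebra_simps)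
  also have "Re (\<tau> * cnj \<kappa>) = - ((norm \<kappa>)\<^sup>2 * Re (b - a))"
    unfolding \<tau>\<kappa> cmod_power2 by (simp add: algebra_simps power2_eq_square)
  finally have "(norm \<kappa>)\<^sup>2 * Re (b - a) \<le> 0" by simp
  moreover have "\<kappa> \<noteq> 0" using near \<rho> by auto
  ultimately have "Re (b - a) \<le> 0" by (simp add: mult_le_0_iff)
  then show ?thesis by simp
qed simp

text \<open>
  The times in the cone that can be reached form a relatively open set, because \<open>P\<close> is an open
  map. They also form a relatively closed one: the inverse of \<open>P\<close> is Lipschitz, so preimages
  converge along convergent times, and by the preceding lemma the limit stays away from the
  imaginary axis. The cone is connected, so all of its times are reached.
\<close>

lemma cone_in_image:
  assumes a: "Re a < 0" and \<tau>: "\<tau> \<in> time_cone c \<rho>"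
  shows "P a - \<tau> \<in> P ` {v. Re v < 0}"
proof -
  let ?T = "time_cone c \<rho>"
  define A where "A = {\<tau> \<in> ?T. P a - \<tau> \<in> P ` {v. Re v < 0}}"
  have "open ((\<lambda>\<tau>. P a - \<tau>) -` (P ` {v. Re v < 0}))"
    by (intro open_vimage open_image continuous_intros)
  moreover have "A = ?T \<inter> (\<lambda>\<tau>. P a - \<tau>) -` (P ` {v. Re v < 0})" by (auto simp: A_def)
  ultimately have "openin (top_of_set ?T) A" by (auto simp: openin_open)
  moreover have "closedin (top_of_set ?T) A"
    unfolding closedin_limpt
  proof (intro conjI allI impI)
    show "A \<subseteq> ?T" by (auto simp: A_def)
    fix x assume x: "x islimpt A \<and> x \<in> ?T"
    then obtain s where s: "\<And>n::nat. s n \<in> A" "s \<longlonglongrightarrow> x"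
      by (auto simp: islimpt_sequential)
    then obtain v where v: "\<And>n. Re (v n) < 0" "\<And>n. P (v n) = P a - s n"
      by (simp add: A_def image_iff) metis
    have left: "Re (v n) \<le> Re a" for n
      using cone_step_moves_left[OF a v(1) _ v(2)] s(1)[of n] by (auto simp: A_def)
    have "Cauchy v"
    proof (rule metric_CauchyI)
      fix e :: real assume "e > 0"
      then have "e * (norm c - \<rho>) > 0" using \<rho> by simp
      then obtain N where N: "\<And>m n. m \<ge> N \<Longrightarrow> n \<ge> N \<Longrightarrow> dist (s m) (s n) < e * (norm c - \<rho>)"
        using LIMSEQ_imp_Cauchy[OF s(2)] metric_CauchyD by metis
      have "dist (v m) (v n) < e" if "m \<ge> N" "n \<ge> N" for m n
      proof -
        have "(norm c - \<rho>) * norm (v m - v n) \<le> norm (P (v m) - P (v n))"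
          by (rule expanding) (use v in auto)
        also have "\<dots> = dist (s m) (s n)"
          by (simp add: v(2) dist_norm norm_minus_commute)
        also have "\<dots> < e * (norm c - \<rho>)" using N[OF that] .
        finally show ?thesis using \<rho> by (simp add: dist_norm mult.commute)
      qed
      then show "\<exists>M. \<forall>m\<ge>M. \<forall>n\<ge>M. dist (v m) (v n) < e" by blast
    qed
    then obtain b where b: "v \<longlonglongrightarrow> b" using Cauchy_convergent convergentD by blast
    have "Re b \<le> Re a"
      by (rule tendsto_upperbound[OF tendsto_Re[OF b]]) (use left in auto)
    then have bH: "Re b < 0" using a by simp
    have "(\<lambda>n. P (v n)) \<longlonglongrightarrow> P b"
      using isCont_tendsto_compose[OF DERIV_isCont[OF deriv_P[OF bH]] b] .
    moreover have "(\<lambda>n. P (v n)) \<longlonglongrightarrow> P a - x"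
      unfolding v(2) by (intro tendsto_intros s(2))
    ultimately have "P b = P a - x" by (rule LIMSEQ_unique)
    then show "x \<in> A" using x bH by (auto simp: A_def image_iff intro: exI[of _ b])
  qed
  moreover have "0 \<in> A" using a by (auto simp: A_def time_cone_def)
  moreover have "connected ?T"
    using convex_connected[OF convex_time_cone[OF \<rho>_nonneg]] .
  ultimately have "A = ?T" using connected_clopen by blast
  with \<tau> show ?thesis by (auto simp: A_def)
qed

end

text \<open>
  For \<open>z \<noteq> 0\<close> the solution is \<open>\<tau> \<mapsto> exp (P\<^sup>-\<^sup>1 (P (Ln z) - \<tau>))\<close>. Conversely, a
  solution equals \<open>z * exp (- H)\<close> with \<open>H\<close> a primitive of \<open>h\<close> along it; so it has
  the logarithm \<open>Ln z - H\<close>, along which \<open>P\<close> decreases at unit speed, and it must be given by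
  the same formula. The open set \<open>X\<close> is needed to speak of holomorphy, as the cone is closed.
\<close>

lemma complex_time_flow:
  fixes g h :: "complex \<Rightarrow> complex"
  assumes g: "\<And>z. norm z < 1 \<Longrightarrow> g z = z * h z"
    and holh: "h holomorphic_on ball 0 1"
    and near: "\<And>z. norm z < 1 \<Longrightarrow> norm (1 / h z - c) \<le> \<rho>" and \<rho>c: "\<rho> < Re c"
    and z: "norm z < 1"
  shows "\<exists>F X. open X \<and> time_cone c \<rho> \<subseteq> X \<and> F holomorphic_on X \<and>
           cauchy_solution g z (\<lambda>t. F (of_real t)) \<and>
           (\<forall>u. cauchy_solution g z u \<longrightarrow> (\<forall>t\<ge>0. u t = F (of_real t)))"
proof -
  have h0: "h w \<noteq> 0" if "norm w < 1" for w
    using near[OF that] \<rho>c complex_Re_le_cmod[of c] by auto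
  define H where "H u t = integral {0..t} (\<lambda>s. h (u s))" for u :: "real \<Rightarrow> complex" and t
  have dH: "(H u has_vector_derivative h (u t)) (at t within {0..})"
    if u: "cauchy_solution g z u" and t: "t \<ge> 0" for u t
  proof -
    have "continuous_on {0..} (\<lambda>s. h (u s))"
      by (rule continuous_on_compose2[OF holomorphic_on_imp_continuous_on[OF holh]
            continuous_on_cauchy_solution[OF u]])
         (use cauchy_solution_in_disc[OF u] in auto)
    then have "((\<lambda>t. integral {0..t} (\<lambda>s. h (u s))) has_vector_derivative h (u t))
                 (at t within {0..t + 1})"
      by (intro integral_has_vector_derivative) (use t in \<open>auto intro: continuous_on_subset\<close>)
    also have "at t within {0..t + 1} = at t within {0..}"
      by (rule at_within_nhd[of _ "{..<t + 1}"]) auto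
    finally show ?thesis by (simp add: H_def[abs_def])
  qed
  have rep: "u t = z * exp (- H u t)" if u: "cauchy_solution g z u" and t: "t \<ge> 0" for u t
  proof -
    have "((\<lambda>s. u s * exp (H u s)) has_vector_derivative 0) (at s within {0..})" if "s \<in> {0..}" for s
    proof -
      have s: "s \<ge> 0" using that by simp
      have "((\<lambda>s. exp (H u s)) has_vector_derivative h (u s) * exp (H u s)) (at s within {0..})"
        using field_vector_diff_chain_within[OF dH[OF u s] has_field_derivative_at_within[OF DERIV_exp]]
        by (simp add: o_def)
      from has_vector_derivative_mult[OF cauchy_solution_derivative[OF u s] this]
      show ?thesis using g[OF cauchy_solution_in_disc[OF u s]] by (simp add: algebra_simps)
    qed
    then obtain w where "\<And>s. s \<in> {0..} \<Longrightarrow> u s * exp (H u s) = w"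
      using has_vector_derivative_zero_constant[of "{0..}" "\<lambda>s. u s * exp (H u s)"] by auto
    from this[of 0] this[of t] t have "u t * exp (H u t) = u 0 * exp (H u 0)" by simp
    moreover have "u 0 = z" "H u 0 = 0" using u by (auto simp: cauchy_solution_def H_def)
    ultimately show ?thesis by (simp add: exp_minus field_simps)
  qed
  show ?thesis
  proof (cases "z = 0")
    case True
    have "cauchy_solution g z (\<lambda>t. 0)" using g[of 0] True by (simp add: cauchy_solution_def)
    moreover have "\<forall>u. cauchy_solution g z u \<longrightarrow> (\<forall>t\<ge>0. u t = 0)" using rep True by simp
    ultimately show ?thesis
      by (intro exI[of _ "\<lambda>_. 0"] exI[of _ UNIV]) auto
  next
    case False
    let ?H = "{v. Re v < 0}"
    define k where "k v = 1 / h (exp v)" for v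
    have "k holomorphic_on ?H"
      unfolding k_def using h0
      by (intro holomorphic_intros holomorphic_on_compose_gen[OF _ holh, unfolded o_def]) auto
    then obtain P where P: "\<And>v. v \<in> ?H \<Longrightarrow> (P has_field_derivative k v) (at v within ?H)"
      using holomorphic_convex_primitive'[of ?H k] convex_halfspace_Re_lt open_halfspace_Re_lt by auto
    then have P': "(P has_field_derivative k v) (at v)" if "Re v < 0" for v
      using that at_within_open[OF _ open_halfspace_Re_lt] by (metis mem_Collect_eq)
    interpret nearly_linear_on_half_plane P k c \<rho>
    proof
      show "norm (k v - c) \<le> \<rho>" if "Re v < 0" for v
        using near[of "exp v"] that by (simp add: k_def)
      show "\<rho> < norm c" using \<rho>c complex_Re_le_cmod[of c] by simp
    qed (use P' in auto)
    obtain Q where Q: "Q holomorphic_on (P ` ?H)" "\<And>v. v \<in> ?H \<Longrightarrow> deriv P v * deriv Q (P v) = 1"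
      "\<And>v. v \<in> ?H \<Longrightarrow> Q (P v) = v"
      using holomorphic_has_inverse[OF holomorphic_P open_halfspace_Re_lt inj_P] by blast
    define a where "a = Ln z"
    have a: "exp a = z" "Re a < 0" using False z by (auto simp: a_def)
    define X where "X = (\<lambda>\<tau>. P a - \<tau>) -` (P ` ?H)"
    define F where "F \<tau> = exp (Q (P a - \<tau>))" for \<tau>
    have "open X" unfolding X_def by (intro open_vimage open_image continuous_intros)
    have cone: "time_cone c \<rho> \<subseteq> X" using cone_in_image[OF a(2)] by (auto simp: X_def)
    have holF: "F holomorphic_on X"
      unfolding F_def X_def
      by (intro holomorphic_intros holomorphic_on_compose_gen[OF _ Q(1), unfolded o_def]) auto
    have dF: "norm (F \<tau>) < 1 \<and> (F has_field_derivative - g (F \<tau>)) (at \<tau>)" if "\<tau> \<in> X" for \<tau>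
    proof -
      have "P a - \<tau> \<in> P ` ?H" using that by (simp add: X_def)
      then obtain v where v: "Re v < 0" "P a - \<tau> = P v" by (elim imageE) simp
      have F\<tau>: "F \<tau> = exp v" using Q(3) v by (simp add: F_def)
      have n: "norm (exp v) < 1" using v by simp
      have "deriv P v = k v" using DERIV_imp_deriv[OF P'[OF v(1)]] .
      then have dQ: "deriv Q (P v) = h (exp v)"
        using Q(2)[of v] v(1) h0[OF n]
        unfolding \<open>deriv P v = k v\<close> k_def by (simp add: field_simps)
      have "(Q has_field_derivative h (exp v)) (at (P a - \<tau>))"
        using holomorphic_derivI[OF Q(1) open_image, of "P v"] v dQ by auto
      then have "((\<lambda>\<tau>. Q (P a - \<tau>)) has_field_derivative h (exp v) * (-1)) (at \<tau>)"
        by (rule DERIV_chain2) (auto intro!: derivative_eq_intros)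
      then have "(F has_field_derivative exp v * (h (exp v) * (-1))) (at \<tau>)"
        unfolding F_def[abs_def]
        using DERIV_chain2[OF DERIV_exp, of "\<lambda>\<tau>. Q (P a - \<tau>)"] v Q(3) by fastforce
      then show ?thesis using g[OF n] n F\<tau> by simp
    qed
    have tX: "of_real t \<in> X" if "t \<ge> 0" for t
      using of_real_in_time_cone[of \<rho> c t] \<rho>c that cone by auto
    have sol: "cauchy_solution g z (\<lambda>t. F (of_real t))"
      unfolding cauchy_solution_def
    proof (intro conjI allI impI)
      show "F (of_real 0) = z" using a Q(3) by (simp add: F_def)
    next
      fix t :: real assume "0 \<le> t"
      note d = dF[OF tX[OF this]]
      then show "F (of_real t) \<in> unit_disc" by simp
      have "((\<lambda>t. of_real t) has_vector_derivative 1) (at t within {0..})"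
        by (auto intro!: derivative_eq_intros)
      from field_vector_diff_chain_within[OF this has_field_derivative_at_within[OF conjunct2[OF d]]]
      show "((\<lambda>t. F (of_real t)) has_vector_derivative - g (F (of_real t))) (at t within {0..})"
        by (simp add: o_def)
    qed
    have uniq: "u t = F (of_real t)" if u: "cauchy_solution g z u" and t: "t \<ge> 0" for u t
    proof -
      define v where "v s = a - H u s" for s
      have ev: "exp (v s) = u s" if "s \<ge> 0" for s
        using rep[OF u that] a(1) by (simp add: v_def exp_diff exp_minus divide_inverse)
      have vH: "Re (v s) < 0" if "s \<ge> 0" for s
        using cauchy_solution_in_disc[OF u that] ev[OF that] norm_exp_eq_Re[of "v s"] by simp
      have "((\<lambda>s. P (v s) + of_real s) has_vector_derivative 0) (at s within {0..})"
        if "s \<in> {0..}" for s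
      proof -
        have s: "s \<ge> 0" using that by simp
        have "(v has_vector_derivative - h (u s)) (at s within {0..})"
          unfolding v_def[abs_def] using dH[OF u s] by (auto intro!: derivative_eq_intros)
        from field_vector_diff_chain_within[OF this has_field_derivative_at_within[OF P'[OF vH[OF s]]]]
        have "((\<lambda>s. P (v s)) has_vector_derivative - h (u s) * k (v s)) (at s within {0..})"
          by (simp add: o_def)
        moreover have "- h (u s) * k (v s) = -1"
          using ev[OF s] h0[OF cauchy_solution_in_disc[OF u s]] by (simp add: k_def)
        ultimately show ?thesis by (auto intro!: derivative_eq_intros)
      qed
      then obtain w where "\<And>s. s \<in> {0..} \<Longrightarrow> P (v s) + of_real s = w"
        using has_vector_derivative_zero_constant[of "{0..}" "\<lambda>s. P (v s) + of_real s"] by auto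
      from this[of 0] this[of t] t have "P (v t) = P (v 0) - of_real t"
        by (simp add: eq_diff_eq)
      moreover have "v 0 = a" by (simp add: v_def H_def)
      ultimately have "Q (P a - of_real t) = v t" using Q(3) vH[OF t] by (metis mem_Collect_eq)
      then show ?thesis using ev[OF t] by (simp add: F_def)
    qed
    from \<open>open X\<close> cone holF sol uniq show ?thesis by blast
  qed
qed

section \<open>Sectors of times\<close>

text \<open>Jordan's inequality: the sine is concave and so lies above its chord.\<close>

lemma sin_ge_two_over_pi:
  fixes x :: real
  assumes "0 \<le> x" "x \<le> pi / 2"
  shows "2 * x / pi \<le> sin x"
proof -
  have "concave_on {0..pi/2} (sin :: real \<Rightarrow> real)"
  proof (rule f''_le0_imp_concave[of _ _ cos "\<lambda>x. - sin x"])
    show "- sin x \<le> 0" if "x \<in> {0..pi/2}" for x :: real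
      using sin_ge_zero[of x] that by simp
  qed (auto intro!: derivative_eq_intros)
  moreover have "0 \<le> 2 * x / pi" "2 * x / pi \<le> 1" using assms by (auto simp: field_simps)
  ultimately have "(1 - 2 * x / pi) * sin 0 + 2 * x / pi * sin (pi / 2)
      \<le> sin ((1 - 2 * x / pi) *\<^sub>R 0 + (2 * x / pi) *\<^sub>R (pi / 2))"
    by (rule concave_onD) auto
  then show ?thesis by simp
qed

text \<open>
  The cone is the closed sector with axis \<open>\<gamma> = Arg c\<close> and half-angle
  \<open>\<beta> = arccos (\<rho> / norm c)\<close>, and \<open>\<rho> < Re c\<close> says that the direction \<open>0\<close> lies
  strictly inside. A sector of smaller opening with the same axis may miss that direction;
  scaling the axis down to \<open>\<gamma> * (\<omega> / 2) / \<beta>\<close> brings it inside while the sector stays in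
  the cone.
\<close>

lemma sector_in_time_cone:
  assumes \<rho>: "0 \<le> \<rho>" "\<rho> < Re c" and \<omega>: "0 \<le> \<omega>" "\<omega> / 2 \<le> arccos (\<rho> / norm c)"
  shows "\<exists>\<phi>. (sector \<phi> \<omega> \<noteq> {} \<longrightarrow> of_real ` {0<..} \<subseteq> sector \<phi> \<omega>) \<and>
              sector \<phi> \<omega> \<subseteq> time_cone c \<rho>"
proof -
  define \<gamma> where "\<gamma> = Arg c"
  define \<beta> where "\<beta> = arccos (\<rho> / norm c)"
  have c: "\<rho> < norm c" "norm c > 0" "c \<noteq> 0"
    using \<rho> complex_Re_le_cmod[of c] by auto
  have quot: "0 \<le> \<rho> / norm c" "\<rho> / norm c < 1" using \<rho> c by auto
  have cos\<beta>: "cos \<beta> = \<rho> / norm c" using quot by (simp add: \<beta>_def)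
  have \<beta>: "0 < \<beta>" "\<beta> \<le> pi"
    using quot arccos_lt_bounded[of "\<rho> / norm c"] by (auto simp: \<beta>_def)
  have c_polar: "c = of_real (norm c) * exp (\<i> * of_real \<gamma>)"
    using is_Arg_Arg[OF c(3)] by (simp add: is_Arg_def \<gamma>_def)
  have "Re c = norm c * cos \<gamma>"
    by (subst c_polar) (simp add: Re_exp)
  then have "cos \<beta> < cos \<gamma>" using \<rho>(2) c(2) by (simp add: cos\<beta> field_simps)
  then have \<gamma>: "\<bar>\<gamma>\<bar> < \<beta>"
  proof -
    have "\<not> \<beta> \<le> \<bar>\<gamma>\<bar>"
    proof
      assume "\<beta> \<le> \<bar>\<gamma>\<bar>"
      then have "cos \<bar>\<gamma>\<bar> \<le> cos \<beta>"
        using \<beta> Arg_bounded[of c] by (intro cos_monotone_0_pi_le) (auto simp: \<gamma>_def)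
      with \<open>cos \<beta> < cos \<gamma>\<close> show False by simp
    qed
    then show ?thesis by simp
  qed
  define \<phi> where "\<phi> = \<gamma> * (\<omega> / 2 / \<beta>)"
  have ratio: "0 \<le> \<omega> / 2 / \<beta>" "\<omega> / 2 / \<beta> \<le> 1"
    using \<omega> \<beta> by (auto simp: \<beta>_def)
  have "\<bar>\<gamma> - \<phi>\<bar> = \<bar>\<gamma>\<bar> * (1 - \<omega> / 2 / \<beta>)"
  proof -
    have "\<gamma> - \<phi> = \<gamma> * (1 - \<omega> / 2 / \<beta>)" by (simp add: \<phi>_def algebra_simps)
    then show ?thesis using ratio by (simp add: abs_mult)
  qed
  also have "\<dots> \<le> \<beta> * (1 - \<omega> / 2 / \<beta>)"
    using \<gamma> ratio by (intro mult_right_mono) auto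
  also have "\<dots> = \<beta> - \<omega> / 2" using \<beta> by (simp add: field_simps)
  finally have near: "\<bar>\<gamma> - \<phi>\<bar> \<le> \<beta> - \<omega> / 2" .
  have sub: "sector \<phi> \<omega> \<subseteq> time_cone c \<rho>"
  proof
    fix t assume "t \<in> sector \<phi> \<omega>"
    then obtain \<theta> where \<theta>: "is_Arg t \<theta>" "\<bar>\<theta> - \<phi>\<bar> < \<omega> / 2" by (auto simp: sector_def)
    have "\<bar>\<theta> - \<gamma>\<bar> \<le> \<beta>" using near \<theta>(2) by linarith
    then have "cos \<beta> \<le> cos \<bar>\<theta> - \<gamma>\<bar>" using \<beta> by (intro cos_monotone_0_pi_le) auto
    then have cos: "\<rho> \<le> norm c * cos (\<theta> - \<gamma>)" using c(2) by (simp add: cos\<beta> field_simps)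
    have "t * cnj c = of_real (norm t) * exp (\<i> * of_real \<theta>) * cnj (of_real (norm c) * exp (\<i> * of_real \<gamma>))"
      using \<theta>(1) c_polar unfolding is_Arg_def by metis
    also have "\<dots> = of_real (norm t * norm c) * exp (\<i> * of_real (\<theta> - \<gamma>))"
      by (simp add: exp_cnj exp_diff exp_minus algebra_simps divide_inverse)
    finally have "Re (t * cnj c) = norm t * (norm c * cos (\<theta> - \<gamma>))"
      by (simp add: Re_exp)
    then show "t \<in> time_cone c \<rho>"
      using mult_left_mono[OF cos norm_ge_zero[of t]] by (simp add: time_cone_def mult.commute)
  qed
  have "of_real t \<in> sector \<phi> \<omega>" if ne: "sector \<phi> \<omega> \<noteq> {}" and "t > 0" for t
  proof -
    have "\<omega> > 0"
    proof -
      obtain \<theta> where "\<bar>\<theta> - \<phi>\<bar> < \<omega> / 2" using ne unfolding sector_def by blast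
      then show ?thesis using abs_ge_zero[of "\<theta> - \<phi>"] by linarith
    qed
    have "\<bar>\<phi>\<bar> = \<bar>\<gamma>\<bar> * (\<omega> / 2 / \<beta>)" 
      unfolding \<phi>_def abs_mult abs_of_nonneg[OF ratio(1)] ..
    also have "\<dots> < \<beta> * (\<omega> / 2 / \<beta>)"
      using \<gamma> \<open>\<omega> > 0\<close> \<beta> by (intro mult_strict_right_mono) auto
    finally have "\<bar>0 - \<phi>\<bar> < \<omega> / 2" using \<beta> by simp
    moreover have "is_Arg (of_real t) 0" using \<open>t > 0\<close> by (simp add: is_Arg_def)
    ultimately show ?thesis using \<open>t > 0\<close> unfolding sector_def by auto
  qed
  with sub show ?thesis by (intro exI[of _ \<phi>]) auto
qed

section \<open>The semigroup of the resolvent\<close>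

theorem corollary5p1:
  fixes f :: "complex \<Rightarrow> complex" and q :: complex and r :: real
  assumes "generator f"
    and "f 0 = 0"
    and "q = deriv f 0"
    and "Re q > 0"
    and "r \<ge> 6 / Re q"
  shows "generator (nonlinear_resolvent r f) \<and>
    semigroup_extends_to_sector_of_opening (nonlinear_resolvent r f)
      (pi * ((r * Re q - 6) / (r * Re q + 6)))"
proof -
  define s where "s = r * Re q"
  have s: "s \<ge> 6" using assms(4,5) by (simp add: s_def field_simps)
  have r: "r > 0" using assms(4,5) less_le_trans[of 0 "6 / Re q" r] by simp
  have holf: "f holomorphic_on ball 0 1" using assms(1) by (simp add: generator_def)
  obtain p where p: "p holomorphic_on ball 0 1" "\<And>z. norm z < 1 \<Longrightarrow> f z = z * p z" "deriv f 0 = p 0"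
    using Schwarz3[OF holf assms(2)] by blast
  have p0: "p 0 = q" using p(3) assms(3) by simp
  have re: "0 \<le> Re (p z)" if z: "norm z < 1" for z
  proof (cases "z = 0")
    case False
    have "cnj z * f z = of_real ((norm z)\<^sup>2) * p z"
      using p(2)[OF z] complex_norm_square[of z] by (simp add: mult_ac)
    then have "Re (cnj z * f z) = (norm z)\<^sup>2 * Re (p z)" by simp
    then show ?thesis using generator_inward[OF assms(1,2) z] False by (simp add: zero_le_mult_iff)
  qed (use p0 assms(4) in simp)
  have q0: "0 < Re (p 0)" using p0 assms(4) by simp
  define G where "G = nonlinear_resolvent r f"
  have G: "G holomorphic_on ball 0 1" "\<And>w. norm w < 1 \<Longrightarrow> norm (G w) < 1"
    "\<And>w. norm w < 1 \<Longrightarrow> G w * (1 + of_real r * p (G w)) = w"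
    using resolvent_of_generator[of p f r, OF p(1,2) re r] by (auto simp: G_def)
  define h where "h w = 1 / (1 + of_real r * p (G w))" for w
  have ne: "1 + of_real r * p (G w) \<noteq> 0" if "norm w < 1" for w
  proof -
    have "Re (1 + of_real r * p (G w)) > 0" using re[OF G(2)[OF that]] r by (simp add: add_pos_nonneg)
    then show ?thesis by (metis less_irrefl zero_complex.sel(1))
  qed
  \<comment> \<open>The disc that contains all values of \<open>1 + r p\<close> on the image of \<open>G\<close>.\<close>
  define c where "c = 1 + of_real r * q"
  define \<rho> where "\<rho> = 2 * s / (s - 2)"
  have Rec: "Re c = 1 + s" by (simp add: c_def s_def)
  have \<rho>: "0 \<le> \<rho>" "\<rho> \<le> 3" using s by (auto simp: \<rho>_def field_simps)
  have \<rho>c: "\<rho> < Re c" using \<rho> s Rec by simp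
  \<comment> \<open>The resolvent contracts strongly: \<open>norm (G w) * norm (1 + r p (G w)) < 1\<close>, and the
    second factor is bounded below by Harnack's inequality. For \<open>x = norm (G w)\<close> the resulting
    quadratic inequality factors with \<open>1 - x\<close> as one factor.\<close>
  have small: "norm (G w) \<le> 1 / (s - 1)" if w: "norm w < 1" for w
  proof -
    define x where "x = norm (G w)"
    have x: "0 \<le> x" "x < 1" using G(2)[OF w] by (auto simp: x_def)
    have "Re q * (1 - x) / (1 + x) \<le> Re (p (G w))"
      using Re_ge_of_Re_nonneg[OF p(1) re q0 G(2)[OF w]] by (simp add: p0 x_def)
    then have "r * (Re q * (1 - x) / (1 + x)) \<le> r * Re (p (G w))"
      using r by (intro mult_left_mono) auto
    then have "1 + s * (1 - x) / (1 + x) \<le> Re (1 + of_real r * p (G w))"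
      by (simp add: s_def mult.assoc)
    also have "\<dots> \<le> norm (1 + of_real r * p (G w))" by (rule complex_Re_le_cmod)
    finally have "x * (1 + s * (1 - x) / (1 + x)) \<le> x * norm (1 + of_real r * p (G w))"
      using x by (intro mult_left_mono)
    also have "\<dots> = norm w" using G(3)[OF w] by (metis norm_mult x_def)
    finally have "x * (1 + s * (1 - x) / (1 + x)) < 1" using w by simp
    then have "x * ((1 + x) + s * (1 - x)) < 1 + x" using x by (simp add: field_simps)
    then have "0 < (1 - x) * (1 - (s - 1) * x)" by (simp add: algebra_simps)
    then have "0 < 1 - (s - 1) * x" using x by (simp add: zero_less_mult_iff)
    then show ?thesis using s by (simp add: x_def field_simps)
  qed
  have near: "norm (1 / h w - c) \<le> \<rho>" if w: "norm w < 1" for w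
  proof -
    define x where "x = norm (G w)"
    have x: "0 \<le> x" "x \<le> 1 / (s - 1)" "x < 1"
      using small[OF w] G(2)[OF w] by (auto simp: x_def)
    have "1 / h w - c = of_real r * (p (G w) - p 0)"
      by (simp add: h_def c_def p0 algebra_simps)
    then have "norm (1 / h w - c) = r * norm (p (G w) - p 0)"
      using r by (simp add: norm_mult)
    also have "\<dots> \<le> r * (2 * Re (p 0) * x / (1 - x))"
      using norm_diff_le_of_Re_nonneg[OF p(1) re q0 G(2)[OF w]] r
      by (intro mult_left_mono) (auto simp: x_def)
    also have "\<dots> = 2 * s * (x / (1 - x))" by (simp add: p0 s_def)
    also have "\<dots> \<le> 2 * s * (1 / (s - 2))"
    proof (rule mult_left_mono)
      show "x / (1 - x) \<le> 1 / (s - 2)" using x s by (simp add: field_simps)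
    qed (use s in simp)
    finally show ?thesis by (simp add: \<rho>_def)
  qed
  have flow: "\<exists>F X. open X \<and> time_cone c \<rho> \<subseteq> X \<and> F holomorphic_on X \<and>
           cauchy_solution G z (\<lambda>t. F (of_real t)) \<and>
           (\<forall>u. cauchy_solution G z u \<longrightarrow> (\<forall>t\<ge>0. u t = F (of_real t)))" if z: "norm z < 1" for z
  proof (rule complex_time_flow[OF _ _ near \<rho>c z])
    show "G w = w * h w" if "norm w < 1" for w
      using G(3)[OF that] ne[OF that] by (simp add: h_def field_simps)
    have "(\<lambda>w. p (G w)) holomorphic_on ball 0 1"
      by (rule holomorphic_on_compose_gen[OF G(1) p(1), unfolded o_def]) (use G(2) in force)
    then show "h holomorphic_on ball 0 1"
      unfolding h_def using ne by (intro holomorphic_intros) auto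
  qed
  have gen: "generator G"
    unfolding generator_def
  proof (intro conjI ballI)
    fix z assume "z \<in> unit_disc"
    then obtain F :: "complex \<Rightarrow> complex" where "cauchy_solution G z (\<lambda>t. F (of_real t))"
      "\<forall>u. cauchy_solution G z u \<longrightarrow> (\<forall>t\<ge>0. u t = F (of_real t))"
      using flow[of z] by auto
    then show "\<exists>u. cauchy_solution G z u \<and> (\<forall>v. cauchy_solution G z v \<longrightarrow> (\<forall>t\<ge>0. v t = u t))"
      by blast
  qed (use G in auto)
  define \<omega> where "\<omega> = pi * ((s - 6) / (s + 6))"
  have \<omega>: "0 \<le> \<omega>" using s by (simp add: \<omega>_def)
  \<comment> \<open>The disc is seen from the origin under the half-angle \<open>arcsin (\<rho> / norm c)\<close>; the
    half-opening \<open>\<omega> / 2\<close> is admissible if that angle is at most \<open>x\<close>.\<close>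
  define x where "x = pi / 2 - \<omega> / 2"
  have x: "x = 6 * pi / (s + 6)" using s by (simp add: x_def \<omega>_def field_simps)
  have x_bounds: "0 \<le> x" "x \<le> pi / 2"
    using s \<omega> by (simp add: x) (use \<omega> in \<open>simp add: x_def\<close>)
  have "\<rho> / norm c \<le> 3 / (s + 1)"
    using \<rho> Rec complex_Re_le_cmod[of c] s by (intro frac_le) auto
  also have "\<dots> \<le> 12 / (s + 6)" using s by (simp add: field_simps)
  also have "\<dots> = 2 * x / pi" by (simp add: x)
  also have "\<dots> \<le> sin x" by (rule sin_ge_two_over_pi[OF x_bounds])
  also have "\<dots> = cos (\<omega> / 2)" by (simp add: x_def sin_diff)
  finally have le_cos: "\<rho> / norm c \<le> cos (\<omega> / 2)" .
  have "\<omega> / 2 = arccos (cos (\<omega> / 2))"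
    using \<omega> x_bounds by (simp add: arccos_cos x_def)
  also have "\<dots> \<le> arccos (\<rho> / norm c)"
  proof (rule arccos_le_arccos)
    have "0 \<le> \<rho> / norm c" using \<rho>(1) by simp
    then show "- 1 \<le> \<rho> / norm c" by linarith
  qed (use le_cos in auto)
  finally obtain \<phi> where \<phi>: "sector \<phi> \<omega> \<noteq> {} \<longrightarrow> of_real ` {0<..} \<subseteq> sector \<phi> \<omega>"
    "sector \<phi> \<omega> \<subseteq> time_cone c \<rho>"
    using sector_in_time_cone[OF \<rho>(1) \<rho>c \<omega>] by blast
  have "semigroup_extends_to_sector_of_opening G \<omega>"
    unfolding semigroup_extends_to_sector_of_opening_def
  proof (rule exI[of _ \<phi>], intro conjI ballI)
    fix z assume z: "z \<in> unit_disc"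
    then obtain F X where F: "time_cone c \<rho> \<subseteq> X" "F holomorphic_on X"
      "cauchy_solution G z (\<lambda>t. F (of_real t))" using flow[of z] by auto
    have "F holomorphic_on sector \<phi> \<omega>"
      using F(1,2) \<phi>(2) holomorphic_on_subset by (metis order_trans)
    moreover have "\<forall>t>0. of_real t \<in> sector \<phi> \<omega> \<longrightarrow> F (of_real t) = generated_semigroup G t z"
      using generated_semigroup_eq[OF gen F(3)] by simp
    ultimately show "\<exists>F. F holomorphic_on sector \<phi> \<omega> \<and>
        (\<forall>t>0. of_real t \<in> sector \<phi> \<omega> \<longrightarrow> F (of_real t) = generated_semigroup G t z)" by blast
  qed (rule \<phi>(1))
  with gen show ?thesis by (simp add: G_def \<omega>_def s_def)
qed

end
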